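(* Let $G$ be a finite simple graph that is a line graph (i.e. $G\cong L(F)$ for some finite simple graph $F$) and is traceable. Then $\gamma_{g}(G)\le \left\lceil \frac{n(G)}{2}\right\rceil$.
   Context: All graphs are finite, simple and undirected (and non-empty); $n(G)$ is the number of vertices of $G$. A graph is traceable if it contains a Hamiltonian path. The line graph $L(F)$ of a graph $F$ has one vertex for each edge of $F$, and two distinct vertices of $L(F)$ are adjacent if and only if the corresponding edges of $F$ share an endpoint. The closed neighborhood of $v$ is $N_G[v]=N_G(v)\cup\{v\}$, and a vertex $v$ dominates exactly the vertices of $N_G[v]$. Domination game: two players, Dominator and Staller, alternately select vertices of $G$; a selected vertex must dominate at least one vertex not dominated by the previously selected vertices, i.e. selecting $v$ is legal if and only if $N_G[v]\not\subseteq \bigcup_{u\in D}N_G[u]$, where $D$ is the set of previously selected vertices. The game ends when no legal move exists (equivalently, when the selected vertices form a dominating set). Dominator wants to minimize the total number of moves, Staller wants to maximize it. The game domination number $\gamma_g(G)$ is the total number of moves (of both players) when Dominator moves first and both players play optimally. *)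

theory Defs
  imports Complex_Main "Graph_Theory.Graph_Theory"
begin

text \<open>
  A finite simple undirected graph is a \<^locale>\<open>pair_graph\<close>: a finite vertex set
  together with a finite, irreflexive and symmetric set of pairs, so that each undirected edge
  is represented by its two orientations. The locale admits the graph without vertices.
\<close>

text \<open>The vertices of the line graph are the undirected edges, as two-element sets.\<close>

definition undirected_edges :: "'a pair_pre_digraph \<Rightarrow> 'a set set" where
  "undirected_edges F = {{u, v} | u v. (u, v) \<in> parcs F}"

definition line_graph :: "'a pair_pre_digraph \<Rightarrow> 'a set pair_pre_digraph" where
  "line_graph F =
    \<lparr> pverts = undirected_edges F,
      parcs = {(e, f). e \<in> undirected_edges F \<and> f \<in> undirected_edges F \<and> e \<noteq> f \<and> e \<inter> f \<noteq> {}} \<rparr>"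

lemma pair_graph_line_graph:
  assumes "pair_graph F"
  shows "pair_graph (line_graph F)"
proof -
  interpret pair_graph F by fact
  have "undirected_edges F = (\<lambda>(u, v). {u, v}) ` parcs F"
    unfolding undirected_edges_def by auto
  then have fin: "finite (undirected_edges F)"
    using pair_finite_arcs by simp
  have "parcs (line_graph F) \<subseteq> undirected_edges F \<times> undirected_edges F"
    unfolding line_graph_def by auto
  then have "finite (parcs (line_graph F))"
    using fin by (meson finite_SigmaI finite_subset)
  then show ?thesis
    using fin
    by unfold_locales (auto simp: line_graph_def symmetric_def intro!: symI)
qed

definition traceable :: "'a pair_pre_digraph \<Rightarrow> bool" where
  "traceable G \<longleftrightarrow> (\<exists>p. vpath p (with_proj G) \<and> set p = pverts G)"

definition closed_nbhd :: "'a pair_pre_digraph \<Rightarrow> 'a \<Rightarrow> 'a set" where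
  "closed_nbhd G v = {w. (v, w) \<in> parcs G} \<union> {v}"

definition legal_moves :: "'a pair_pre_digraph \<Rightarrow> 'a set \<Rightarrow> 'a set" where
  "legal_moves G D = {v \<in> pverts G. \<not> closed_nbhd G v \<subseteq> (\<Union>u\<in>D. closed_nbhd G u)}"

datatype player = Dominator | Staller

text \<open>
  The number of moves still to be made under optimal play when the vertices in \<open>D\<close> have been
  selected and the given player is to move. The finiteness test only serves to make
  the recursion terminate on infinite vertex sets.
\<close>

function remaining_moves :: "'a pair_pre_digraph \<Rightarrow> player \<Rightarrow> 'a set \<Rightarrow> nat" where
  "remaining_moves G pl D =
    (if infinite (pverts G) \<or> legal_moves G D = {} then 0
     else case pl of
       Dominator \<Rightarrow> 1 + Min ((\<lambda>v. remaining_moves G Staller (insert v D)) ` legal_moves G D)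
     | Staller \<Rightarrow> 1 + Max ((\<lambda>v. remaining_moves G Dominator (insert v D)) ` legal_moves G D))"
  by pat_completeness auto
termination
proof (relation "measure (\<lambda>(G, pl, D). card (pverts G - D))")
  have decr: "card (pverts G - insert v D) < card (pverts G - D)"
    if "\<not> (infinite (pverts G) \<or> legal_moves G D = {})" "v \<in> legal_moves G D"
    for G :: "'a pair_pre_digraph" and D v
  proof (rule psubset_card_mono)
    show "finite (pverts G - D)" using that by simp
    have "v \<in> pverts G" "v \<notin> D" using that by (auto simp: legal_moves_def)
    then show "pverts G - insert v D \<subset> pverts G - D" by auto
  qed
  then show "((G, Staller, insert v D), (G, pl, D)) \<in> measure (\<lambda>(G, pl, D). card (pverts G - D))"
    if "\<not> (infinite (pverts G) \<or> legal_moves G D = {})" "v \<in> legal_moves G D"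
    for G :: "'a pair_pre_digraph" and pl D v
    using that by simp
  show "((G, Dominator, insert v D), (G, pl, D)) \<in> measure (\<lambda>(G, pl, D). card (pverts G - D))"
    if "\<not> (infinite (pverts G) \<or> legal_moves G D = {})" "v \<in> legal_moves G D"
    for G :: "'a pair_pre_digraph" and pl D v
    using that decr by simp
qed simp

declare remaining_moves.simps [simp del]

definition game_domination_number :: "'a pair_pre_digraph \<Rightarrow> nat" where
  "game_domination_number G = remaining_moves G Dominator {}"

end

theory Submission
  imports Defs
begin

text \<open>
  Play on the edges of \<open>F\<close>: the undominated edges form a residual edge set \<open>R\<close>, and selecting an
  edge \<open>e\<close> deletes from \<open>R\<close> all edges meeting \<open>e\<close>. Carry along a system of edge-disjoint
  trails in \<open>R\<close> such that every edge of \<open>R\<close> has an endpoint on a trail, and take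
  as potential \<open>|R|\<close> plus the number of trails. Since a trail has one more vertex occurrence
  than edges, this is the number of vertex occurrences plus the number of edges off the trails; so
  cutting the trails at a vertex set \<open>A\<close> lowers the potential by exactly the occurrences in \<open>A\<close> plus
  the edges off the trails that meet \<open>A\<close>. Hence each move of Staller costs at least 1, while
  Dominator can always make the potential drop by 3 unless \<open>R\<close> is a matching, in which case the
  potential is at least \<open>2 |R|\<close> and at most \<open>|R|\<close> moves remain. So when Dominator
  starts, the number of moves is at most half the potential. A Hamiltonian path of \<open>L(F)\<close> yields a single
  dominating trail, i.e. initial potential \<open>n + 1\<close>.
\<close>

section \<open>Trail systems, cutting at a vertex set, and the potential\<close>

definition residual :: "'a set set \<Rightarrow> 'a set \<Rightarrow> 'a set set" where
  "residual R A = {e \<in> R. e \<inter> A = {}}"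

text \<open>A list of optional vertices encodes a system of trails, with \<^const>\<open>None\<close> separating them.\<close>

fun links :: "'a option list \<Rightarrow> 'a set list" where
  "links (Some x # Some y # L) = {x, y} # links (Some y # L)"
| "links (Some x # None # L) = links L"
| "links (None # L) = links L"
| "links [Some x] = []"
| "links [] = []"

text \<open>Erased vertices become separators instead of being dropped, since dropping them would
  make their neighbours on the list consecutive and create false links.\<close>

definition erase :: "'a set \<Rightarrow> 'a option list \<Rightarrow> 'a option list" where
  "erase A L = map (\<lambda>z. if z \<in> Some ` A then None else z) L"

text \<open>Occurrences are counted with multiplicity, as a trail may return to a vertex;
  \<open>A = UNIV\<close> counts all entries that are not separators.\<close>

definition visits :: "'a option list \<Rightarrow> 'a set \<Rightarrow> nat" where
  "visits L A = length (filter (\<lambda>z. z \<in> Some ` A) L)"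

text \<open>A dominating system of edge-disjoint trails. An isolated entry \<open>Some x\<close> is
  a trivial trail without edges, which cutting may leave behind.\<close>

definition covers :: "'a set set \<Rightarrow> 'a option list \<Rightarrow> bool" where
  "covers R L \<longleftrightarrow>
    distinct (links L) \<and> set (links L) \<subseteq> R \<and> (\<forall>e\<in>R. \<exists>x\<in>e. Some x \<in> set L)"

definition off_trail :: "'a set set \<Rightarrow> 'a option list \<Rightarrow> 'a set \<Rightarrow> 'a set set" where
  "off_trail R L A = {e \<in> R - set (links L). e \<inter> A \<noteq> {}}"

definition potential :: "'a set set \<Rightarrow> 'a option list \<Rightarrow> nat" where
  "potential R L = visits L UNIV + card (R - set (links L))"

lemma links_erase: "links (erase A L) = filter (\<lambda>e. e \<inter> A = {}) (links L)"
  unfolding erase_def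
proof (induction L rule: links.induct)
  case (1 x y L)
  then show ?case by (cases L; cases "hd L") (auto split: if_splits)
qed auto

lemma visits_erase: "visits (erase A L) UNIV + visits L A = visits L UNIV"
  unfolding visits_def erase_def by (induction L) (auto simp: image_iff)

lemma visits_insert:
  "x \<notin> A \<Longrightarrow> visits L (insert x A) = count_list L (Some x) + visits L A"
  unfolding visits_def by (induction L) auto

lemma visits_empty [simp]: "visits L {} = 0"
  unfolding visits_def by simp

text \<open>The description by positions lets \<open>good_move\<close> compare where two links lie
  on the list.\<close>

lemma set_links_iff:
  "e \<in> set (links L) \<longleftrightarrow>
    (\<exists>i x y. Suc i < length L \<and> L ! i = Some x \<and> L ! Suc i = Some y \<and> e = {x, y})"
proof (induction L rule: links.induct)
  case (1 x y L)
  show ?case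
  proof
    assume "e \<in> set (links (Some x # Some y # L))"
    then consider "e = {x, y}" | "e \<in> set (links (Some y # L))" by auto
    then show "\<exists>i u v. Suc i < length (Some x # Some y # L) \<and> (Some x # Some y # L) ! i = Some u
        \<and> (Some x # Some y # L) ! Suc i = Some v \<and> e = {u, v}"
    proof cases
      case 1
      then show ?thesis by (intro exI[of _ 0]) auto
    next
      case 2
      then obtain i u v where "Suc i < length (Some y # L)" "(Some y # L) ! i = Some u"
        "(Some y # L) ! Suc i = Some v" "e = {u, v}" using 1 by blast
      then show ?thesis by (intro exI[of _ "Suc i"]) auto
    qed
  next
    assume "\<exists>i u v. Suc i < length (Some x # Some y # L) \<and> (Some x # Some y # L) ! i = Some u
        \<and> (Some x # Some y # L) ! Suc i = Some v \<and> e = {u, v}"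
    then obtain i u v where i: "Suc i < length (Some x # Some y # L)"
      "(Some x # Some y # L) ! i = Some u" "(Some x # Some y # L) ! Suc i = Some v" "e = {u, v}"
      by blast
    show "e \<in> set (links (Some x # Some y # L))"
    proof (cases i)
      case 0
      then show ?thesis using i by auto
    next
      case (Suc j)
      then have "Suc j < length (Some y # L)" "(Some y # L) ! j = Some u"
        "(Some y # L) ! Suc j = Some v" using i by auto
      then have "e \<in> set (links (Some y # L))" using 1 i(4) by blast
      then show ?thesis by simp
    qed
  qed
next
  case (2 x L)
  have "(\<exists>i u v. Suc i < length (Some x # None # L) \<and> (Some x # None # L) ! i = Some u
        \<and> (Some x # None # L) ! Suc i = Some v \<and> e = {u, v}) \<longleftrightarrow>
      (\<exists>i u v. Suc i < length L \<and> L ! i = Some u \<and> L ! Suc i = Some v \<and> e = {u, v})"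
    (is "?A \<longleftrightarrow> ?B")
  proof
    assume ?A
    then obtain i u v where "Suc i < length (Some x # None # L)"
      "(Some x # None # L) ! i = Some u" "(Some x # None # L) ! Suc i = Some v" "e = {u, v}"
      by blast
    moreover then obtain j where "i = Suc (Suc j)"
      by (cases i; cases "i - 1") auto
    ultimately show ?B by (intro exI[of _ j]) auto
  next
    assume ?B
    then obtain i u v where "Suc i < length L" "L ! i = Some u" "L ! Suc i = Some v" "e = {u, v}"
      by blast
    then show ?A by (intro exI[of _ "Suc (Suc i)"]) auto
  qed
  then show ?case using 2 by simp
next
  case (3 L)
  have "(\<exists>i u v. Suc i < length (None # L) \<and> (None # L) ! i = Some u
        \<and> (None # L) ! Suc i = Some v \<and> e = {u, v}) \<longleftrightarrow>
      (\<exists>i u v. Suc i < length L \<and> L ! i = Some u \<and> L ! Suc i = Some v \<and> e = {u, v})"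
    (is "?A \<longleftrightarrow> ?B")
  proof
    assume ?A
    then obtain i u v where "Suc i < length (None # L)"
      "(None # L) ! i = Some u" "(None # L) ! Suc i = Some v" "e = {u, v}"
      by blast
    moreover then obtain j where "i = Suc j"
      by (cases i) auto
    ultimately show ?B by (intro exI[of _ j]) auto
  next
    assume ?B
    then obtain i u v where "Suc i < length L" "L ! i = Some u" "L ! Suc i = Some v" "e = {u, v}"
      by blast
    then show ?A by (intro exI[of _ "Suc i"]) auto
  qed
  then show ?case using 3 by simp
qed auto

lemma links_vertex:
  assumes "e \<in> set (links L)" "x \<in> e"
  shows "Some x \<in> set L"
  using assms unfolding set_links_iff by (metis Suc_lessD empty_iff insert_iff nth_mem)

lemma visits_pos:
  assumes "Some x \<in> set L" "x \<in> A"
  shows "visits L A \<ge> 1"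
  using assms unfolding visits_def
  by (metis (no_types, lifting) One_nat_def Suc_leI filter_empty_conv imageI length_greater_0_conv)

lemma nth_eq_of_count_list:
  assumes "count_list L x = 1" "i < length L" "j < length L" "L ! i = x" "L ! j = x"
  shows "i = j"
proof -
  have "card {i. i < length L \<and> x = L ! i} = 1"
    using assms(1) by (simp add: count_list_eq_length_filter length_filter_conv_card)
  then obtain k where k: "{i. i < length L \<and> x = L ! i} = {k}" by (rule card_1_singletonE)
  have "i \<in> {k}" "j \<in> {k}" unfolding k[symmetric] using assms(2-) by simp_all
  then show ?thesis by simp
qed

text \<open>The links that survive are exactly those avoiding \<open>A\<close>, so an edge avoiding
  \<open>A\<close> stays on or off the trails as before. Hence the loss is an exact sum: the erased
  occurrences plus the off-trail edges meeting \<open>A\<close>.\<close>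

lemma erase_covers:
  assumes "finite R" "covers R L"
  shows "covers (residual R A) (erase A L)"
    and "potential (residual R A) (erase A L) + visits L A + card (off_trail R L A) = potential R L"
proof -
  have sub: "set (links (erase A L)) = {e \<in> set (links L). e \<inter> A = {}}"
    by (auto simp: links_erase)
  have "\<exists>x\<in>e. Some x \<in> set (erase A L)" if e: "e \<in> R" "e \<inter> A = {}" for e
  proof -
    obtain x where x: "x \<in> e" "Some x \<in> set L" using assms(2) e(1) unfolding covers_def by blast
    then have "x \<notin> A" using e(2) by blast
    then have "Some x \<in> set (erase A L)" using x(2) by (force simp: erase_def)
    then show ?thesis using x(1) by blast
  qed
  then show "covers (residual R A) (erase A L)"
    using assms(2) sub by (auto simp: covers_def residual_def links_erase)
  have "R - set (links L) = (residual R A - set (links (erase A L))) \<union> off_trail R L A"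
    unfolding sub residual_def off_trail_def by blast
  moreover have "(residual R A - set (links (erase A L))) \<inter> off_trail R L A = {}"
    by (auto simp: residual_def off_trail_def)
  moreover have "finite (residual R A)" "finite (off_trail R L A)"
    using assms(1) by (auto simp: residual_def off_trail_def)
  ultimately have "card (R - set (links L)) =
      card (residual R A - set (links (erase A L))) + card (off_trail R L A)"
    by (simp add: card_Un_disjoint)
  then show "potential (residual R A) (erase A L) + visits L A + card (off_trail R L A)
      = potential R L"
    using visits_erase[of A L] by (simp add: potential_def)
qed

section \<open>Lower bounds on the drop of the potential\<close>

lemma count_list_pos: "x \<in> set L \<Longrightarrow> count_list L x \<ge> 1"
  by (metis One_nat_def Suc_leI count_list_0_iff neq0_conv)

text \<open>This is the cost of any move of Staller. A link meeting \<open>A\<close> gives an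
  occurrence in \<open>A\<close>; any other edge meeting \<open>A\<close> is itself counted off the
  trails.\<close>

lemma erase_meeting_edge:
  assumes "finite R" "covers R L" "e \<in> R" "e \<inter> A \<noteq> {}"
  shows "potential (residual R A) (erase A L) + 1 \<le> potential R L"
proof (cases "e \<in> set (links L)")
  case True
  then have "visits L A \<ge> 1" using assms(4) links_vertex visits_pos by fastforce
  then show ?thesis using erase_covers(2)[OF assms(1,2), of A] by simp
next
  case False
  then have "e \<in> off_trail R L A" using assms(3,4) by (auto simp: off_trail_def)
  moreover have "finite (off_trail R L A)" using assms(1) by (auto simp: off_trail_def)
  ultimately have "card (off_trail R L A) \<ge> 1"
    by (metis One_nat_def Suc_leI card_gt_0_iff empty_iff)
  then show ?thesis using erase_covers(2)[OF assms(1,2), of A] by simp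
qed

text \<open>Both ends of a link are visited. An off-trail edge counts once itself, and covering
  supplies one visited end.\<close>

lemma erase_edge:
  assumes "finite R" "covers R L" "e \<in> R" "card e = 2"
  shows "potential (residual R e) (erase e L) + 2 \<le> potential R L"
proof (cases "e \<in> set (links L)")
  case True
  obtain u v where uv: "e = {u, v}" "u \<noteq> v" using assms(4) by (auto simp: card_2_iff)
  then have "count_list L (Some u) \<ge> 1" "count_list L (Some v) \<ge> 1"
    using True links_vertex count_list_pos by fastforce+
  then have "visits L e \<ge> 2" using uv by (simp add: visits_insert)
  then show ?thesis using erase_covers(2)[OF assms(1,2), of e] by simp
next
  case False
  then have "e \<in> off_trail R L e" using assms(3,4) by (auto simp: off_trail_def)
  moreover have "finite (off_trail R L e)" using assms(1) by (auto simp: off_trail_def)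
  ultimately have "card (off_trail R L e) \<ge> 1"
    by (metis One_nat_def Suc_leI card_gt_0_iff empty_iff)
  moreover have "visits L e \<ge> 1" using assms(2,3) visits_pos by (fastforce simp: covers_def)
  ultimately show ?thesis using erase_covers(2)[OF assms(1,2), of e] by simp
qed

text \<open>In a matching, cutting at an edge removes only that edge, at a cost of at least 2 by
  \<open>erase_edge\<close>.\<close>

lemma matching_potential:
  assumes "finite R" "\<forall>e\<in>R. card e = 2" "covers R L" "pairwise disjnt R"
  shows "2 * card R \<le> potential R L"
  using assms
proof (induction "card R" arbitrary: R L)
  case 0
  then show ?case by simp
next
  case (Suc n)
  then obtain e where e: "e \<in> R" by (metis card.empty equals0I nat.distinct(1))
  have "e \<noteq> {}" using e Suc.prems(2) by auto
  then have res: "residual R e = R - {e}"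
    using e Suc.prems(4) by (auto simp: residual_def pairwise_def disjnt_def)
  have "2 * card (R - {e}) \<le> potential (residual R e) (erase e L)"
    unfolding res[symmetric]
  proof (rule Suc.hyps(1))
    show "n = card (residual R e)" using Suc.hyps(2) Suc.prems(1) e res by simp
    show "finite (residual R e)" "\<forall>e'\<in>residual R e. card e' = 2" "pairwise disjnt (residual R e)"
      using Suc.prems res by (auto simp: pairwise_def)
    show "covers (residual R e) (erase e L)" using erase_covers(1) Suc.prems by blast
  qed
  moreover have "potential (residual R e) (erase e L) + 2 \<le> potential R L"
    using erase_edge Suc.prems e by blast
  ultimately show ?case using Suc.hyps(2) Suc.prems(1) e by simp
qed

text \<open>Dominator's strategy. If no edge gains 3, the losses are so restricted that adjacent
  edges must be links and ends of links are visited only once; an end of a trail then provides the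
  missing gain.\<close>

lemma good_move:
  assumes fin: "finite R" and two: "\<forall>e\<in>R. card e = 2" and cov: "covers R L"
    and npw: "\<not> pairwise disjnt R"
  shows "\<exists>e\<in>R. \<exists>L'. covers (residual R e) L' \<and> potential (residual R e) L' + 3 \<le> potential R L"
proof (rule ccontr)
  assume no: "\<not> ?thesis"
  \<comment> \<open>The cut set \<open>A\<close> may be larger than the selected edge as long as it
    destroys the same edges; the extra vertex used at the end relies on this freedom.\<close>
  have bound: "visits L A + card (off_trail R L A) \<le> 2"
    if "e \<in> R" "residual R A = residual R e" for e A
  proof (rule ccontr)
    assume "\<not> ?thesis"
    then have "potential (residual R e) (erase A L) + 3 \<le> potential R L"
      using erase_covers(2)[OF fin cov, of A] that(2) by simp
    then show False
      using no that erase_covers(1)[OF fin cov, of A] by auto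
  qed
  have fin_off: "finite (off_trail R L A)" for A using fin by (auto simp: off_trail_def)
  \<comment> \<open>If \<open>e\<close> is off the trails, the bound is exhausted by
    \<open>e\<close> itself and one visit of \<open>u\<close>. So \<open>v\<close> is unvisited and
    \<open>e'\<close> is a link through \<open>u\<close>; selecting \<open>e'\<close> then loses
    both its ends and \<open>e\<close>, three in total.\<close>
  have on_trail: "e \<in> set (links L)" if ee: "e \<in> R" "e' \<in> R" "e \<noteq> e'" "e \<inter> e' \<noteq> {}" for e e'
  proof (rule ccontr)
    assume off: "e \<notin> set (links L)"
    obtain u where u: "u \<in> e" "Some u \<in> set L" using cov ee(1) by (auto simp: covers_def)
    obtain v where v: "e = {u, v}" "u \<noteq> v"
      using two ee(1) u(1) by (metis card_2_iff insertE insert_commute singletonD)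
    have cu: "count_list L (Some u) \<ge> 1" using u count_list_pos by fast
    have eoff: "e \<in> off_trail R L e" using off ee(1) u(1) by (auto simp: off_trail_def)
    then have c1: "card (off_trail R L e) \<ge> 1"
      using fin_off by (metis One_nat_def Suc_leI card_gt_0_iff empty_iff)
    have sum: "count_list L (Some u) + count_list L (Some v) + card (off_trail R L e) \<le> 2"
      using bound[OF ee(1) refl] v by (simp add: visits_insert)
    have "card (off_trail R L e) = 1" "count_list L (Some v) = 0" using sum cu c1 by linarith+
    then have "off_trail R L e = {e}" "Some v \<notin> set L"
      using eoff by (auto simp: card_1_singleton_iff count_list_0_iff)
    then have e': "e' \<in> set (links L)" using ee by (auto simp: off_trail_def)
    then have "v \<notin> e'" using \<open>Some v \<notin> set L\<close> links_vertex by fast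
    then have "u \<in> e'" using ee(4) v by auto
    then obtain w where w: "e' = {u, w}" "u \<noteq> w"
      using two ee(2) by (metis card_2_iff insertE insert_commute singletonD)
    then have "count_list L (Some w) \<ge> 1"
      using e' links_vertex count_list_pos by fastforce
    then have "visits L e' \<ge> 2" using w cu by (simp add: visits_insert)
    moreover have "e \<in> off_trail R L e'" using off ee by (auto simp: off_trail_def)
    then have "card (off_trail R L e') \<ge> 1"
      using fin_off by (metis One_nat_def Suc_leI card_gt_0_iff empty_iff)
    ultimately show False using bound[OF ee(2) refl] by simp
  qed
  \<comment> \<open>One visit to each end already exhausts the bound.\<close>
  have trail_edge: "off_trail R L e = {} \<and> (\<forall>x\<in>e. count_list L (Some x) = 1)"
    if "e \<in> set (links L)" for e
  proof -
    have eR: "e \<in> R" using that cov by (auto simp: covers_def)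
    then obtain u v where uv: "e = {u, v}" "u \<noteq> v" using two by (metis card_2_iff)
    have "count_list L (Some u) \<ge> 1" "count_list L (Some v) \<ge> 1"
      using uv that links_vertex count_list_pos by fastforce+
    moreover have "count_list L (Some u) + count_list L (Some v) + card (off_trail R L e) \<le> 2"
      using bound[OF eR refl] uv by (simp add: visits_insert)
    ultimately have "card (off_trail R L e) = 0 \<and> count_list L (Some u) = 1
        \<and> count_list L (Some v) = 1" by linarith
    then show ?thesis using fin_off uv by auto
  qed
  \<comment> \<open>Adjacent edges are consecutive on one trail. The first such pair \<open>uv\<close>, \<open>vw\<close> starts a trail and \<open>u\<close>
    has degree 1, so playing \<open>vw\<close> also isolates \<open>u\<close>, and three occurrences can be erased.\<close>
  define triple where "triple k \<longleftrightarrow> (\<exists>u v w. Suc (Suc k) < length L \<and> L ! k = Some u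
      \<and> L ! Suc k = Some v \<and> L ! Suc (Suc k) = Some w)" for k
  obtain e e' where ee: "e \<in> R" "e' \<in> R" "e \<noteq> e'" "e \<inter> e' \<noteq> {}"
    using npw by (auto simp: pairwise_def disjnt_def)
  have el: "e \<in> set (links L)" "e' \<in> set (links L)" using on_trail ee by blast+
  obtain i x y where i: "Suc i < length L" "L ! i = Some x" "L ! Suc i = Some y" "e = {x, y}"
    using el(1) unfolding set_links_iff by blast
  obtain j x' y' where j: "Suc j < length L" "L ! j = Some x'" "L ! Suc j = Some y'" "e' = {x', y'}"
    using el(2) unfolding set_links_iff by blast
  obtain z where z: "z \<in> e" "z \<in> e'" using ee by blast
  then have cz: "count_list L (Some z) = 1" using trail_edge el by blast
  have pos: "a = b" if "L ! a = Some z" "L ! b = Some z" "a < length L" "b < length L" for a b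
    using nth_eq_of_count_list[OF cz] that by blast
  have ij: "i \<noteq> j" using i j ee(3) by auto
  have "Suc i = j \<or> Suc j = i"
    using z i j ij pos[of i "Suc j"] pos[of "Suc i" j] pos[of i j] pos[of "Suc i" "Suc j"] by auto
  then have "\<exists>k. triple k" using i j unfolding triple_def by metis
  then obtain k where tk: "triple k" and minimal: "\<And>l. l < k \<Longrightarrow> \<not> triple l"
    using exists_least_iff[of triple] by blast
  obtain u v w where k: "Suc (Suc k) < length L" "L ! k = Some u"
      "L ! Suc k = Some v" "L ! Suc (Suc k) = Some w"
    using tk unfolding triple_def by blast
  have uv: "{u, v} \<in> set (links L)" unfolding set_links_iff
    using k by (intro exI[of _ k] exI[of _ u] exI[of _ v]) auto
  have vw: "{v, w} \<in> set (links L)" unfolding set_links_iff using k by blast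
  have vwR: "{v, w} \<in> R" "{u, v} \<in> R" using uv vw cov by (auto simp: covers_def)
  have cu: "count_list L (Some u) = 1" "count_list L (Some v) = 1" "count_list L (Some w) = 1"
    using trail_edge uv vw by blast+
  have dist: "u \<noteq> v" "u \<noteq> w" "v \<noteq> w"
    using nth_eq_of_count_list[OF cu(1), of k "Suc (Suc k)"]
      nth_eq_of_count_list[OF cu(1), of k "Suc k"]
      nth_eq_of_count_list[OF cu(2), of "Suc k" "Suc (Suc k)"] k by auto
  have "v \<in> g" if g: "g \<in> R" "u \<in> g" for g
  proof -
    have "g \<in> set (links L)"
      using trail_edge[OF uv] g by (auto simp: off_trail_def)
    then obtain m a b where m: "Suc m < length L" "L ! m = Some a" "L ! Suc m = Some b" "g = {a, b}"
      unfolding set_links_iff by blast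
    have upos: "l = k" if "L ! l = Some u" "l < length L" for l
      using nth_eq_of_count_list[OF cu(1)] that k by (meson Suc_lessD)
    show ?thesis
    proof (cases "a = u")
      case True
      then have "m = k" using upos m by auto
      then show ?thesis using m k by auto
    next
      case False
      \<comment> \<open>Here \<open>g\<close> would lead into \<open>u\<close> from the preceding
        position and form an earlier triple together with the link from \<open>u\<close> to
        \<open>v\<close>.\<close>
      then have "Suc m = k" using upos m g(2) by auto
      then have "triple m" unfolding triple_def using m k by auto
      then show ?thesis using minimal[of m] \<open>Suc m = k\<close> by blast
    qed
  qed
  then have "residual R {u, v, w} = residual R {v, w}" by (auto simp: residual_def)
  then have "visits L {u, v, w} \<le> 2" using bound[OF vwR(1), of "{u, v, w}"] by simp
  then show False using dist cu by (simp add: visits_insert)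
qed

section \<open>From a Hamiltonian path of the line graph to a dominating trail\<close>

text \<open>Prescribing the start \<open>x\<close> drives the induction: the trail for the remaining
  edges starts at a vertex \<open>w\<close> common to the first two edges. If \<open>w = x\<close>
  it already meets \<open>e\<close>; otherwise \<open>e = {x, w}\<close> is prepended as a link, new
  because \<open>es\<close> is distinct.\<close>

lemma hamiltonian_trail:
  assumes "successively (\<lambda>e e'. e \<inter> e' \<noteq> {}) es" "distinct es" "\<forall>e\<in>set es. card e = 2"
    and "es \<noteq> []" "x \<in> hd es"
  shows "\<exists>xs. xs \<noteq> [] \<and> hd xs = x \<and> distinct (links (map Some xs))
    \<and> set (links (map Some xs)) \<subseteq> set es \<and> (\<forall>e\<in>set es. e \<inter> set xs \<noteq> {})"
  using assms
proof (induction es arbitrary: x rule: induct_list012)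
  case 1
  then show ?case by simp
next
  case (2 e)
  then show ?case by (intro exI[of _ "[x]"]) auto
next
  case (3 e e' es)
  obtain w where w: "w \<in> e" "w \<in> e'" using 3(3) by auto
  obtain xs where xs: "xs \<noteq> []" "hd xs = w" "distinct (links (map Some xs))"
    "set (links (map Some xs)) \<subseteq> set (e' # es)" "\<forall>f\<in>set (e' # es). f \<inter> set xs \<noteq> {}"
    using 3(2)[of w] 3(3-) w by auto
  have wxs: "w \<in> set xs" using xs(1,2) by auto
  show ?case
  proof (cases "w = x")
    case True
    then show ?thesis using xs w wxs by (intro exI[of _ xs]) auto
  next
    case False
    then have e: "e = {x, w}" using 3 w
      by (metis card_2_iff insertE list.sel(1) list.set_intros(1) singletonD doubleton_eq_iff)
    obtain ys where ys: "xs = w # ys" using xs(1,2) by (cases xs) auto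
    have "e \<notin> set (links (map Some xs))" using xs(4) 3(4) by auto
    then show ?thesis using xs e ys 3(4) by (intro exI[of _ "x # xs"]) auto
  qed
qed

lemma length_links_map_Some: "xs \<noteq> [] \<Longrightarrow> Suc (length (links (map Some xs))) = length xs"
  by (induction xs rule: induct_list012) auto

text \<open>A single trail with \<open>k\<close> links has \<open>k + 1\<close> occurrences and
  leaves \<open>length es - k\<close> edges off it.\<close>

lemma hamiltonian_covers:
  assumes "successively (\<lambda>e e'. e \<inter> e' \<noteq> {}) es" "distinct es" "\<forall>e\<in>set es. card e = 2" "es \<noteq> []"
  shows "\<exists>L. covers (set es) L \<and> potential (set es) L = Suc (length es)"
proof -
  have "hd es \<noteq> {}" using assms(3,4) by (metis card.empty hd_in_set zero_neq_numeral)
  then obtain x where x: "x \<in> hd es" by blast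
  obtain xs where xs: "xs \<noteq> []" "distinct (links (map Some xs))"
    "set (links (map Some xs)) \<subseteq> set es" "\<forall>e\<in>set es. e \<inter> set xs \<noteq> {}"
    using hamiltonian_trail[OF assms x] by blast
  have "covers (set es) (map Some xs)"
    using xs unfolding covers_def by (simp add: image_iff) blast
  moreover have "visits (map Some xs) UNIV = length xs" by (simp add: visits_def)
  moreover have "card (set es - set (links (map Some xs))) = length es - length (links (map Some xs))"
    using xs assms(2) by (simp add: card_Diff_subset distinct_card)
  moreover have "length (links (map Some xs)) \<le> length es"
    using xs assms(2) by (metis List.finite_set card_mono distinct_card)
  ultimately show ?thesis
    using length_links_map_Some[OF xs(1)] by (intro exI[of _ "map Some xs"]) (simp add: potential_def)
qed

section \<open>The domination game played on edge labels\<close>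

locale edge_labelling =
  fixes G :: "'a pair_pre_digraph" and f :: "'a \<Rightarrow> 'b set"
  assumes finite_verts: "finite (pverts G)"
    and card_label: "v \<in> pverts G \<Longrightarrow> card (f v) = 2"
    and nbhd: "v \<in> pverts G \<Longrightarrow> closed_nbhd G v = {w \<in> pverts G. f v \<inter> f w \<noteq> {}}"
begin

definition undominated :: "'a set \<Rightarrow> 'b set set" where
  "undominated D = residual (f ` pverts G) (\<Union> (f ` D))"

lemma finite_undominated: "finite (undominated D)"
  using finite_verts by (simp add: undominated_def residual_def)

lemma card_undominated: "\<forall>e\<in>undominated D. card e = 2"
  using card_label by (auto simp: undominated_def residual_def)

lemma undominated_insert: "undominated (insert v D) = residual (undominated D) (f v)"
  by (auto simp: undominated_def residual_def)

lemma legal_iff: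
  assumes "D \<subseteq> pverts G"
  shows "v \<in> legal_moves G D \<longleftrightarrow> v \<in> pverts G \<and> (\<exists>e\<in>undominated D. e \<inter> f v \<noteq> {})"
proof (cases "v \<in> pverts G")
  case True
  have "(\<Union>u\<in>D. closed_nbhd G u) = (\<Union>u\<in>D. {w \<in> pverts G. f u \<inter> f w \<noteq> {}})"
    using assms nbhd by (intro SUP_cong) auto
  then have "v \<in> legal_moves G D \<longleftrightarrow>
      \<not> {w \<in> pverts G. f v \<inter> f w \<noteq> {}} \<subseteq> (\<Union>u\<in>D. {w \<in> pverts G. f u \<inter> f w \<noteq> {}})"
    using True nbhd[OF True] by (simp add: legal_moves_def)
  also have "\<dots> \<longleftrightarrow>
      (\<exists>w\<in>pverts G. f w \<inter> f v \<noteq> {} \<and> (\<forall>u\<in>D. f w \<inter> f u = {}))"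
    unfolding subset_iff mem_Collect_eq UN_iff by (metis Int_commute)
  also have "\<dots> \<longleftrightarrow> (\<exists>e\<in>undominated D. e \<inter> f v \<noteq> {})"
  proof -
    have dom: "e \<inter> \<Union> (f ` D) = {} \<longleftrightarrow> (\<forall>u\<in>D. e \<inter> f u = {})" for e
      by (simp only: Int_commute[of e] Union_disjoint ball_simps)
    have "(\<exists>w\<in>pverts G. P (f w) \<and> Q (f w)) \<longleftrightarrow> (\<exists>e\<in>{e \<in> f ` pverts G. Q e}. P e)" for P Q
      by blast
    then show ?thesis unfolding undominated_def residual_def dom .
  qed
  finally show ?thesis using True by simp
next
  case False
  then show ?thesis by (simp add: legal_moves_def)
qed

lemma legal_of_undominated:
  assumes "D \<subseteq> pverts G" "v \<in> pverts G" "f v \<in> undominated D"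
  shows "v \<in> legal_moves G D"
proof -
  have "f v \<inter> f v \<noteq> {}" using card_label[OF assms(2)] by auto
  then show ?thesis unfolding legal_iff[OF assms(1)] using assms(2,3) by (intro conjI bexI)
qed

lemma finite_legal: "finite (legal_moves G D)"
  using finite_verts by (simp add: legal_moves_def)

text \<open>Dominator minimises, so one legal move yields an upper bound; for Staller every legal
  move has to be bounded.\<close>

lemma remaining_Dominator_le:
  assumes "v \<in> legal_moves G D"
  shows "remaining_moves G Dominator D \<le> Suc (remaining_moves G Staller (insert v D))"
proof -
  have "Min ((\<lambda>v. remaining_moves G Staller (insert v D)) ` legal_moves G D)
      \<le> remaining_moves G Staller (insert v D)"
    using assms finite_legal by (intro Min_le) auto
  then show ?thesis
    using assms finite_verts by (subst remaining_moves.simps) auto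
qed

lemma remaining_Staller_le:
  assumes "\<And>v. v \<in> legal_moves G D \<Longrightarrow> Suc (remaining_moves G Dominator (insert v D)) \<le> k"
  shows "remaining_moves G Staller D \<le> k"
proof (cases "legal_moves G D = {}")
  case True
  then show ?thesis by (subst remaining_moves.simps) auto
next
  case False
  have "Max ((\<lambda>v. remaining_moves G Dominator (insert v D)) ` legal_moves G D)
      \<in> (\<lambda>v. remaining_moves G Dominator (insert v D)) ` legal_moves G D"
    using False finite_legal by (intro Max_in) auto
  then have "Suc (Max ((\<lambda>v. remaining_moves G Dominator (insert v D)) ` legal_moves G D)) \<le> k"
    using assms by force
  then show ?thesis
    using False finite_verts by (subst remaining_moves.simps) auto
qed

lemma card_undominated_insert:
  assumes "D \<subseteq> pverts G" "v \<in> legal_moves G D"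
  shows "card (undominated (insert v D)) < card (undominated D)"
proof (rule psubset_card_mono[OF finite_undominated])
  obtain e where "e \<in> undominated D" "e \<inter> f v \<noteq> {}"
    using assms(2) unfolding legal_iff[OF assms(1)] by blast
  then show "undominated (insert v D) \<subset> undominated D"
    unfolding undominated_insert by (intro psubsetI) (auto simp: residual_def)
qed

text \<open>Each legal move removes at least one undominated edge, whoever plays. This bounds the
  final phase, when only a matching is left.\<close>

lemma remaining_le_card:
  assumes "D \<subseteq> pverts G"
  shows "remaining_moves G pl D \<le> card (undominated D)"
  using assms
proof (induction "card (undominated D)" arbitrary: D pl rule: less_induct)
  case less
  have IH: "Suc (remaining_moves G pl' (insert v D)) \<le> card (undominated D)"
    if "v \<in> legal_moves G D" for v pl'
  proof -
    have "insert v D \<subseteq> pverts G" using less.prems that by (auto simp: legal_moves_def)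
    then show ?thesis
      using less.hyps[of "insert v D" pl'] card_undominated_insert[OF less.prems that] by simp
  qed
  show ?case
  proof (cases pl)
    case Staller
    then show ?thesis using IH remaining_Staller_le by blast
  next
    case Dominator
    show ?thesis
    proof (cases "legal_moves G D = {}")
      case True
      then show ?thesis by (subst remaining_moves.simps) auto
    next
      case False
      then obtain v where v: "v \<in> legal_moves G D" by blast
      show ?thesis using remaining_Dominator_le[OF v] IH[OF v, of Staller] Dominator by simp
    qed
  qed
qed

text \<open>Both bounds are proved together by induction on the number of undominated edges. With
  potential \<open>P\<close>, a drop of 3 by Dominator gives
  \<open>1 + (P - 2) div 2 = P div 2\<close>, and a drop of 1 by Staller gives
  \<open>1 + (P - 1) div 2 = (P + 1) div 2\<close>.\<close>

lemma remaining_le_potential: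
  assumes "D \<subseteq> pverts G" "covers (undominated D) L"
  shows "remaining_moves G Dominator D \<le> potential (undominated D) L div 2"
    and "remaining_moves G Staller D \<le> Suc (potential (undominated D) L) div 2"
  using assms
proof (induction "card (undominated D)" arbitrary: D L rule: less_induct)
  case less
  note fin = finite_undominated[of D] and two = card_undominated[of D]
  {
    case 1
    show ?case
    proof (cases "pairwise disjnt (undominated D)")
      case True
      then have "2 * card (undominated D) \<le> potential (undominated D) L"
        using matching_potential fin two 1(2) by blast
      then show ?thesis using remaining_le_card[OF 1(1), of Dominator] by simp
    next
      case False
      then obtain e L' where e: "e \<in> undominated D" "covers (residual (undominated D) e) L'"
        "potential (residual (undominated D) e) L' + 3 \<le> potential (undominated D) L"
        using good_move[OF fin two 1(2)] by blast
      obtain v where v: "v \<in> pverts G" "e = f v"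
        using e(1) by (auto simp: undominated_def residual_def)
      have legal: "v \<in> legal_moves G D" using legal_of_undominated 1(1) v e(1) by blast
      have "remaining_moves G Staller (insert v D)
          \<le> Suc (potential (undominated (insert v D)) L') div 2"
        using less(2)[OF card_undominated_insert[OF 1(1) legal]] 1(1) v e(2)
        by (simp add: undominated_insert)
      then have "remaining_moves G Dominator D
          \<le> Suc (Suc (potential (residual (undominated D) e) L') div 2)"
        using remaining_Dominator_le[OF legal] v by (simp add: undominated_insert)
      then show ?thesis using e(3) by linarith
    qed
  next
    case 2
    show ?case
    proof (rule remaining_Staller_le)
      fix v
      assume legal: "v \<in> legal_moves G D"
      then obtain e where v: "v \<in> pverts G" and e: "e \<in> undominated D" "e \<inter> f v \<noteq> {}"
        unfolding legal_iff[OF 2(1)] by blast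
      have "remaining_moves G Dominator (insert v D)
          \<le> potential (undominated (insert v D)) (erase (f v) L) div 2"
        using less(1)[OF card_undominated_insert[OF 2(1) legal]] 2(1) v
          erase_covers(1)[OF fin 2(2)] by (simp add: undominated_insert)
      moreover have "potential (undominated (insert v D)) (erase (f v) L) + 1
          \<le> potential (undominated D) L"
        unfolding undominated_insert using erase_meeting_edge[OF fin 2(2) e] .
      ultimately show "Suc (remaining_moves G Dominator (insert v D))
          \<le> Suc (potential (undominated D) L) div 2" by linarith
    qed
  }
qed

end

section \<open>Line graph isomorphisms and the bound for traceable line graphs\<close>

lemma vwalk_arcs_successively:
  "set (vwalk_arcs p) \<subseteq> A \<longleftrightarrow> successively (\<lambda>u v. (u, v) \<in> A) p"
  by (induction p rule: induct_list012) auto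

text \<open>A digraph isomorphism maps vertices and arcs separately and carries its own tail and
  head functions. The target being a pair digraph forces these to be \<open>fst\<close> and
  \<open>snd\<close>, so the vertex map determines the arc map.\<close>

lemma line_graph_labelling:
  assumes "digraph_iso (with_proj G) (with_proj (line_graph F))"
  obtains f where "bij_betw f (pverts G) (undirected_edges F)"
    and "\<And>u v. u \<in> pverts G \<Longrightarrow> v \<in> pverts G \<Longrightarrow>
      (u, v) \<in> parcs G \<longleftrightarrow> u \<noteq> v \<and> f u \<inter> f v \<noteq> {}"
proof -
  obtain h where h: "pre_digraph.digraph_isomorphism (with_proj G) h"
    and eq: "with_proj (line_graph F) = app_iso h (with_proj G)"
    using assms unfolding digraph_iso_def by blast
  let ?f = "iso_verts h"
  note iso = h[unfolded pre_digraph.digraph_isomorphism_def, simplified]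
  have verts: "undirected_edges F = ?f ` pverts G"
    using arg_cong[OF eq, of verts] by (simp add: line_graph_def)
  have arcs: "parcs (line_graph F) = iso_arcs h ` parcs G"
    using arg_cong[OF eq, of arcs] by simp
  have th: "iso_tail h = fst" "iso_head h = snd"
    using arg_cong[OF eq, of tail] arg_cong[OF eq, of head] by simp_all
  have inj: "inj_on ?f (pverts G)" using iso by blast
  have wf: "wf_digraph (with_proj G)" using iso by blast
  have ends: "iso_arcs h (u, v) = (?f u, ?f v)" if "(u, v) \<in> parcs G" for u v
    using iso that th by (metis fst_conv snd_conv prod.collapse)
  have ver: "u \<in> pverts G \<and> v \<in> pverts G" if "(u, v) \<in> parcs G" for u v
    using wf_digraph.tail_in_verts[OF wf, of "(u, v)"] wf_digraph.head_in_verts[OF wf, of "(u, v)"]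
      that by simp
  have adj: "(u, v) \<in> parcs G \<longleftrightarrow> (?f u, ?f v) \<in> parcs (line_graph F)"
    if uv: "u \<in> pverts G" "v \<in> pverts G" for u v
  proof
    assume "(u, v) \<in> parcs G"
    then show "(?f u, ?f v) \<in> parcs (line_graph F)" unfolding arcs using ends by force
  next
    assume "(?f u, ?f v) \<in> parcs (line_graph F)"
    then obtain a b where ab: "(a, b) \<in> parcs G" "iso_arcs h (a, b) = (?f u, ?f v)"
      unfolding arcs by auto
    then have "?f a = ?f u" "?f b = ?f v" using ends by auto
    then have "a = u" "b = v" using inj uv ver[OF ab(1)] by (auto dest: inj_onD)
    then show "(u, v) \<in> parcs G" using ab by simp
  qed
  show thesis
  proof (rule that)
    show "bij_betw ?f (pverts G) (undirected_edges F)"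
      using inj verts by (simp add: bij_betw_def)
    show "(u, v) \<in> parcs G \<longleftrightarrow> u \<noteq> v \<and> ?f u \<inter> ?f v \<noteq> {}"
      if "u \<in> pverts G" "v \<in> pverts G" for u v
      using adj[OF that] that verts inj by (auto simp: line_graph_def dest: inj_onD)
  qed
qed

theorem theorem4p12:
  fixes G :: "'a pair_pre_digraph" and F :: "'b pair_pre_digraph"
  assumes "pair_graph G" and "pverts G \<noteq> {}"
    and "pair_graph F" and "digraph_iso (with_proj G) (with_proj (line_graph F))"
    and "traceable G"
  shows "int (game_domination_number G) \<le> \<lceil>real (card (pverts G)) / 2\<rceil>"
proof -
  interpret G: pair_graph G by fact
  interpret F: pair_graph F by fact
  obtain f where bij: "bij_betw f (pverts G) (undirected_edges F)"
    and adj: "\<And>u v. u \<in> pverts G \<Longrightarrow> v \<in> pverts G \<Longrightarrow>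
      (u, v) \<in> parcs G \<longleftrightarrow> u \<noteq> v \<and> f u \<inter> f v \<noteq> {}"
    using line_graph_labelling[OF assms(4)] by blast
  have two: "card (f v) = 2" if "v \<in> pverts G" for v
  proof -
    have "f v \<in> undirected_edges F" using bij that by (auto simp: bij_betw_def)
    then show ?thesis
      using F.no_loops by (fastforce simp: undirected_edges_def card_2_iff)
  qed
  interpret edge_labelling G f
  proof
    show "finite (pverts G)" by simp
    show "card (f v) = 2" if "v \<in> pverts G" for v using two that .
    show "closed_nbhd G v = {w \<in> pverts G. f v \<inter> f w \<noteq> {}}" if "v \<in> pverts G" for v
    proof -
      \<comment> \<open>Being non-empty, \<open>f v\<close> meets itself, which accounts for
        \<open>v\<close> in its own closed neighbourhood.\<close>
      have "f v \<noteq> {}" using two[OF that] by auto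
      then show ?thesis using adj[OF that] that G.in_arcsD2 unfolding closed_nbhd_def by auto
    qed
  qed
  obtain p where p: "vpath p (with_proj G)" "set p = pverts G"
    using assms(5) unfolding traceable_def by blast
  define es where "es = map f p"
  have dp: "distinct p" and wp: "successively (\<lambda>u v. (u, v) \<in> parcs G) p"
    using p(1) vwalk_arcs_successively by (auto simp: vpath_def vwalk_def)
  have "successively (\<lambda>e e'. e \<inter> e' \<noteq> {}) es"
    unfolding es_def successively_map
    using wp by (rule successively_mono) (use adj p(2) in blast)
  moreover have "distinct es" unfolding es_def
    using dp bij p(2) by (simp add: distinct_map bij_betw_def)
  moreover have "\<forall>e\<in>set es. card e = 2" using two p(2) by (auto simp: es_def)
  moreover have "es \<noteq> []" using assms(2) p(2) by (auto simp: es_def)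
  ultimately obtain L where L: "covers (set es) L" "potential (set es) L = Suc (length es)"
    using hamiltonian_covers by blast
  have "undominated {} = set es" by (auto simp: undominated_def residual_def es_def p(2))
  \<comment> \<open>The initial potential is \<open>n + 1\<close>, and \<open>(n + 1) div 2\<close>
    is the ceiling of \<open>n / 2\<close>.\<close>
  then have "game_domination_number G \<le> Suc (length es) div 2"
    unfolding game_domination_number_def using remaining_le_potential(1)[of "{}" L] L by simp
  moreover have "length es = card (pverts G)"
    using dp p(2) by (metis distinct_card es_def length_map)
  ultimately show ?thesis by linarith
qed

end
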